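(* Let $A$ be an ordered alphabet and let $A^{\ast}$ be the free monoid on $A$ ordered by the Higman ordering. Let $F(A^{\ast})$ be the set of final segments of $A^{\ast}$, equipped with concatenation of languages $XY:=\{\alpha\beta:\alpha\in X,\beta\in Y\}$. Then the set $F^{\circ}(A^{\ast}):=F(A^{\ast})\setminus\{\emptyset\}$ of non-empty final segments, with concatenation, is a free monoid.
   Context: Higman ordering on $A^{\ast}$: for $\alpha=a_0\cdots a_{n-1}$ and $\beta=b_0\cdots b_{m-1}$, $\alpha\le\beta$ iff there is a strictly increasing map $h:\{0,\dots,n-1\}\to\{0,\dots,m-1\}$ with $a_i\le b_{h(i)}$ for all $i$. A final segment is a set $F\subseteq A^{\ast}$ such that $\alpha\le\beta$ and $\alpha\in F$ imply $\beta\in F$. The concatenation of two final segments is a final segment, and $A^{\ast}$ is the neutral element, so $F(A^{\ast})$ and $F^{\circ}(A^{\ast})$ are monoids. *)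

theory Defs
  imports "HOL-Algebra.Group"
begin

definition word_monoid :: "'a set \<Rightarrow> 'a list monoid" where
  "word_monoid A = \<lparr>carrier = lists A, mult = (@), one = []\<rparr>"

text \<open>
  A free monoid is a monoid isomorphic to the monoid of words over some set \<open>B\<close>.  Taking \<open>B\<close> in the
  element type of \<open>M\<close> is no restriction: \<open>B\<close> embeds into \<open>M\<close> through its one-letter words.  An
  isomorphism of \<^theory>\<open>HOL-Algebra.Group\<close> is a multiplicative bijection of the carriers; between
  monoids it automatically preserves the unit.
\<close>

definition free_monoid :: "('b, 'm) monoid_scheme \<Rightarrow> bool" where
  "free_monoid M \<longleftrightarrow> monoid M \<and> (\<exists>B :: 'b set. word_monoid B \<cong> M)"

text \<open>The order of the alphabet is a relation \<open>r\<close>, with \<open>(a, b) \<in> r\<close> meaning \<open>a \<le> b\<close>.\<close>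

definition higman_le :: "'a rel \<Rightarrow> 'a list \<Rightarrow> 'a list \<Rightarrow> bool" where
  "higman_le r \<alpha> \<beta> \<longleftrightarrow>
     (\<exists>h :: nat \<Rightarrow> nat. strict_mono_on {..<length \<alpha>} h \<and>
        (\<forall>i<length \<alpha>. h i < length \<beta> \<and> (\<alpha> ! i, \<beta> ! h i) \<in> r))"

definition final_segments :: "'a set \<Rightarrow> 'a rel \<Rightarrow> 'a list set set" where
  "final_segments A r =
     {F. F \<subseteq> lists A \<and> (\<forall>\<alpha>\<in>F. \<forall>\<beta>\<in>lists A. higman_le r \<alpha> \<beta> \<longrightarrow> \<beta> \<in> F)}"

definition lang_concat :: "'a list set \<Rightarrow> 'a list set \<Rightarrow> 'a list set" where
  "lang_concat X Y = {\<alpha> @ \<beta> | \<alpha> \<beta>. \<alpha> \<in> X \<and> \<beta> \<in> Y}"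

definition nonempty_final_segment_monoid :: "'a set \<Rightarrow> 'a rel \<Rightarrow> 'a list set monoid" where
  "nonempty_final_segment_monoid A r =
     \<lparr>carrier = final_segments A r - {{}}, mult = lang_concat, one = lists A\<rparr>"

end

theory Submission
  imports Defs
begin

text \<open>
  By Levi's lemma, a monoid is free if it is equidivisible and carries an additive length that
  vanishes only at the unit. For non-empty final segments, the minimal length of a word is such a
  length. Moreover final segments are closed under prefixing and suffixing arbitrary words, and
  comparing words of minimal length then shows that concatenation is cancellative and that
  \<open>X Y = Z T\<close> forces \<open>X \<subseteq> Z\<close> or \<open>Z \<subseteq> X\<close>. If \<open>X \<subseteq> Z\<close>, the residual \<open>U = {u. u Y \<subseteq> T}\<close> satisfies
  \<open>X \<subseteq> Z U\<close> and \<open>Z U Y \<subseteq> Z T = X Y\<close>, so \<open>X = Z U\<close> and \<open>T = U Y\<close> by cancellation.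
\<close>

section \<open>Levi's lemma\<close>

context monoid
begin

lemma word_product_closed:
  "set ws \<subseteq> carrier G \<Longrightarrow> foldr (\<otimes>) ws \<one> \<in> carrier G"
  by (induction ws) auto

lemma word_product_append:
  "\<lbrakk>set vs \<subseteq> carrier G; set ws \<subseteq> carrier G\<rbrakk>
   \<Longrightarrow> foldr (\<otimes>) (vs @ ws) \<one> = foldr (\<otimes>) vs \<one> \<otimes> foldr (\<otimes>) ws \<one>"
  by (induction vs) (auto simp: word_product_closed m_assoc)

text \<open>Induction on the length factors every element into irreducibles. Equidivisibility makes
  the factorization unique, because the first letters of two equal products must agree and can then
  be stripped together with the rest matched.\<close>

lemma free_monoid_if_equidivisible:
  fixes len :: "'a \<Rightarrow> nat"
  assumes equidivisible:
      "\<And>x y z t. \<lbrakk>x \<in> carrier G; y \<in> carrier G; z \<in> carrier G; t \<in> carrier G; x \<otimes> y = z \<otimes> t\<rbrakk>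
        \<Longrightarrow> \<exists>u\<in>carrier G. (x = z \<otimes> u \<and> t = u \<otimes> y) \<or> (z = x \<otimes> u \<and> y = u \<otimes> t)"
    and len_mult: "\<And>x y. \<lbrakk>x \<in> carrier G; y \<in> carrier G\<rbrakk> \<Longrightarrow> len (x \<otimes> y) = len x + len y"
    and len_zero: "\<And>x. \<lbrakk>x \<in> carrier G; len x = 0\<rbrakk> \<Longrightarrow> x = \<one>"
  shows "free_monoid G"
proof -
  \<comment> \<open>The irreducible elements, the only candidate for a free basis; \<open>f\<close>
    evaluates a word over them in \<open>G\<close>.\<close>
  define B where "B = {b \<in> carrier G. b \<noteq> \<one> \<and>
    (\<forall>x\<in>carrier G. \<forall>y\<in>carrier G. b = x \<otimes> y \<longrightarrow> x = \<one> \<or> y = \<one>)}"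
  define f where "f ws = foldr (\<otimes>) ws \<one>" for ws :: "'a list"
  have B_sub: "B \<subseteq> carrier G"
    by (auto simp: B_def)
  have lists_sub: "set ws \<subseteq> carrier G" if "ws \<in> lists B" for ws
    using that B_sub by auto
  have f_closed: "f ws \<in> carrier G" if "ws \<in> lists B" for ws
    unfolding f_def using lists_sub[OF that] by (rule word_product_closed)
  have f_append: "f (vs @ ws) = f vs \<otimes> f ws" if "vs \<in> lists B" "ws \<in> lists B" for vs ws
    unfolding f_def using that[THEN lists_sub] by (rule word_product_append)
  have f_simps [simp]: "f [] = \<one>" "f (w # ws) = w \<otimes> f ws" for w ws
    by (auto simp: f_def)

  \<comment> \<open>Additivity forces \<open>len \<one> = 0\<close>, so a divisor of
    \<open>\<one>\<close> has length 0 and is \<open>\<one>\<close> itself, which irreducibles are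
    not.\<close>
  have B_mult_not_one: "b \<otimes> x \<noteq> \<one>" if "b \<in> B" "x \<in> carrier G" for b x
  proof
    assume "b \<otimes> x = \<one>"
    moreover have "len \<one> = 0"
      using len_mult[of \<one> \<one>] by simp
    ultimately have "len b = 0"
      using len_mult[of b x] that B_sub by auto
    then show False
      using len_zero[of b] that by (auto simp: B_def)
  qed
  have letter_eq: "b = c \<and> x = y"
    if bc: "b \<in> B" "c \<in> B"
      and xy: "x \<in> carrier G" "y \<in> carrier G" "b \<otimes> x = c \<otimes> y" for b c x y
  proof -
    obtain u where u: "u \<in> carrier G"
      "(b = c \<otimes> u \<and> y = u \<otimes> x) \<or> (c = b \<otimes> u \<and> x = u \<otimes> y)"
      using equidivisible[OF _ xy(1) _ xy(2,3)] bc B_sub by blast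
    \<comment> \<open>If \<open>b = c \<otimes> u\<close>, then \<open>c \<noteq> \<one>\<close> and
      irreducibility of \<open>b\<close> leave only \<open>u = \<one>\<close>; the other case is
      symmetric.\<close>
    then have "u = \<one>"
      using bc unfolding B_def by blast
    then show ?thesis
      using u bc xy B_sub by auto
  qed

  have inj: "v = w" if "v \<in> lists B" "w \<in> lists B" "f v = f w" for v w
    using that
  proof (induction v arbitrary: w rule: list.induct)
    case Nil
    show ?case
    proof (cases w)
      case (Cons c cs)
      then show ?thesis
        using Nil.prems B_mult_not_one[of c "f cs"] f_closed[of cs] by auto
    qed simp
  next
    case (Cons b bs)
    then have b: "b \<in> B" and bs: "bs \<in> lists B"
      by auto
    show ?case
    proof (cases w)
      case Nil
      then show ?thesis
        using Cons.prems(3) B_mult_not_one[OF b f_closed[OF bs]] by simp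
    next
      case w: (Cons c cs)
      then have c: "c \<in> B" and cs: "cs \<in> lists B"
        using Cons.prems(2) by auto
      then have "b = c \<and> f bs = f cs"
        using Cons.prems(3) w by (intro letter_eq b f_closed bs) simp_all
      then show ?thesis
        using Cons.IH bs cs w by simp
    qed
  qed
  have surj: "\<exists>w\<in>lists B. f w = x" if "x \<in> carrier G" for x
    using that
  proof (induction "len x" arbitrary: x rule: less_induct)
    case less
    \<comment> \<open>In the reducible case both factors differ from \<open>\<one>\<close>, so they
      have positive length and each is strictly shorter than \<open>x\<close>.\<close>
    consider "x = \<one>" | "x \<in> B"
      | y z where "y \<in> carrier G" "z \<in> carrier G" "y \<noteq> \<one>" "z \<noteq> \<one>" "x = y \<otimes> z"
      using less.prems by (auto simp: B_def)
    then show ?case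
    proof cases
      case 1
      then show ?thesis by (intro bexI[of _ "[]"]) auto
    next
      case 2
      then show ?thesis using less.prems by (intro bexI[of _ "[x]"]) auto
    next
      case 3
      then have "len y < len x" "len z < len x"
        using len_mult[of y z] len_zero[of y] len_zero[of z] by auto
      then obtain v w where "v \<in> lists B" "f v = y" "w \<in> lists B" "f w = z"
        using less.hyps 3 by meson
      then show ?thesis
        using 3 f_append[of v w] by (intro bexI[of _ "v @ w"]) auto
    qed
  qed

  have "f \<in> iso (word_monoid B) G"
  proof (rule isoI)
    show "f \<in> hom (word_monoid B) G"
      using f_closed f_append by (auto simp: hom_def word_monoid_def)
    show "bij_betw f (carrier (word_monoid B)) (carrier G)"
      unfolding bij_betw_def
    proof
      show "inj_on f (carrier (word_monoid B))"
        using inj by (auto simp: inj_on_def word_monoid_def)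
      show "f ` carrier (word_monoid B) = carrier G"
        using f_closed surj by (fastforce simp: word_monoid_def)
    qed
  qed
  then show ?thesis
    unfolding free_monoid_def is_iso_def using monoid_axioms by blast
qed

end

section \<open>The Higman ordering and concatenation\<close>

lemma higman_le_Nil: "higman_le r [] \<beta>"
  by (auto simp: higman_le_def strict_mono_on_def)

lemma higman_le_refl:
  assumes "refl_on A r" "\<alpha> \<in> lists A"
  shows "higman_le r \<alpha> \<alpha>"
  using assms unfolding higman_le_def
  by (intro exI[of _ id]) (auto simp: strict_mono_on_def refl_on_def in_lists_conv_set)

text \<open>The two embeddings are placed side by side, the second one shifted past the end of
  \<open>\<alpha>'\<close>.\<close>

lemma higman_le_append_mono:
  assumes "higman_le r \<alpha> \<alpha>'" "higman_le r \<beta> \<beta>'"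
  shows "higman_le r (\<alpha> @ \<beta>) (\<alpha>' @ \<beta>')"
proof -
  obtain g where g: "strict_mono_on {..<length \<alpha>} g"
    "\<And>i. i < length \<alpha> \<Longrightarrow> g i < length \<alpha>' \<and> (\<alpha> ! i, \<alpha>' ! g i) \<in> r"
    using assms(1) unfolding higman_le_def by blast
  obtain h where h: "strict_mono_on {..<length \<beta>} h"
    "\<And>i. i < length \<beta> \<Longrightarrow> h i < length \<beta>' \<and> (\<beta> ! i, \<beta>' ! h i) \<in> r"
    using assms(2) unfolding higman_le_def by blast
  define k where "k i = (if i < length \<alpha> then g i else length \<alpha>' + h (i - length \<alpha>))" for i
  have "strict_mono_on {..<length (\<alpha> @ \<beta>)} k"
  proof (rule strict_mono_onI)
    fix i j assume ij: "i \<in> {..<length (\<alpha> @ \<beta>)}" "j \<in> {..<length (\<alpha> @ \<beta>)}" "i < j"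
    consider "j < length \<alpha>" | "i < length \<alpha>" "\<not> j < length \<alpha>" | "\<not> i < length \<alpha>"
      by blast
    then show "k i < k j"
    proof cases
      case 1
      then show ?thesis
        using ij strict_mono_onD[OF g(1), of i j] by (auto simp: k_def)
    next
      case 2
      then show ?thesis
        using g(2)[of i] by (auto simp: k_def)
    next
      case 3
      then show ?thesis
        using ij strict_mono_onD[OF h(1), of "i - length \<alpha>" "j - length \<alpha>"]
        by (auto simp: k_def)
    qed
  qed
  moreover have "k i < length (\<alpha>' @ \<beta>') \<and> ((\<alpha> @ \<beta>) ! i, (\<alpha>' @ \<beta>') ! k i) \<in> r"
    if "i < length (\<alpha> @ \<beta>)" for i
    using that g(2)[of i] h(2)[of "i - length \<alpha>"] by (auto simp: k_def nth_append)
  ultimately show ?thesis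
    unfolding higman_le_def by blast
qed

text \<open>Cutting \<open>\<gamma>\<close> just before the image of the first letter of
  \<open>\<beta>\<close> separates the images of \<open>\<alpha>\<close> and \<open>\<beta>\<close>.
  If \<open>\<beta>\<close> is empty there is no such image, and the cut is made at the end of
  \<open>\<gamma>\<close>.\<close>

lemma higman_le_append_split:
  assumes "higman_le r (\<alpha> @ \<beta>) \<gamma>"
  obtains \<gamma>1 \<gamma>2 where "\<gamma> = \<gamma>1 @ \<gamma>2" "higman_le r \<alpha> \<gamma>1" "higman_le r \<beta> \<gamma>2"
proof (cases "\<beta> = []")
  case True
  then show ?thesis
    using that[of \<gamma> "[]"] assms higman_le_Nil by auto
next
  case False
  obtain h where mono: "strict_mono_on {..<length (\<alpha> @ \<beta>)} h"
    and h: "\<And>i. i < length (\<alpha> @ \<beta>) \<Longrightarrow> h i < length \<gamma> \<and> ((\<alpha> @ \<beta>) ! i, \<gamma> ! h i) \<in> r"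
    using assms unfolding higman_le_def by blast
  define k where "k = h (length \<alpha>)"
  have less_k: "h i < k" if "i < length \<alpha>" for i
    using that strict_mono_onD[OF mono, of i "length \<alpha>"] False by (auto simp: k_def)
  have ge_k: "k \<le> h (length \<alpha> + i)" if "i < length \<beta>" for i
    using that strict_mono_onD[OF mono, of "length \<alpha>" "length \<alpha> + i"] False
    by (cases "i = 0") (auto simp: k_def)
  have "higman_le r \<alpha> (take k \<gamma>)"
    unfolding higman_le_def
  proof (intro exI[of _ h] conjI allI impI)
    show "strict_mono_on {..<length \<alpha>} h"
      using mono by (auto simp: strict_mono_on_def)
  next
    fix i assume i: "i < length \<alpha>"
    then show "h i < length (take k \<gamma>)" "(\<alpha> ! i, take k \<gamma> ! h i) \<in> r"
      using h[of i] less_k[OF i] by (auto simp: nth_append)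
  qed
  moreover have "higman_le r \<beta> (drop k \<gamma>)"
    unfolding higman_le_def
  proof (intro exI[of _ "\<lambda>i. h (length \<alpha> + i) - k"] conjI allI impI)
    show "strict_mono_on {..<length \<beta>} (\<lambda>i. h (length \<alpha> + i) - k)"
    proof (rule strict_mono_onI)
      fix i j assume "i \<in> {..<length \<beta>}" "j \<in> {..<length \<beta>}" "i < j"
      then show "h (length \<alpha> + i) - k < h (length \<alpha> + j) - k"
        using strict_mono_onD[OF mono, of "length \<alpha> + i" "length \<alpha> + j"] ge_k[of i]
        by (auto intro: diff_less_mono)
    qed
  next
    fix i assume i: "i < length \<beta>"
    then show "h (length \<alpha> + i) - k < length (drop k \<gamma>)"
      "(\<beta> ! i, drop k \<gamma> ! (h (length \<alpha> + i) - k)) \<in> r"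
      using h[of "length \<alpha> + i"] ge_k[OF i] by auto
  qed
  ultimately show ?thesis
    using that[of "take k \<gamma>" "drop k \<gamma>"] by simp
qed

section \<open>Concatenation of final segments\<close>

lemma append_eq_append_suffix:
  assumes "xs @ ys = us @ vs" "length xs \<le> length us"
  shows "\<exists>ws. ys = ws @ vs"
  using assms by (metis append_eq_append_conv_if)

lemma lang_concatI: "\<lbrakk>\<alpha> \<in> X; \<beta> \<in> Y\<rbrakk> \<Longrightarrow> \<alpha> @ \<beta> \<in> lang_concat X Y"
  by (auto simp: lang_concat_def)

lemma lang_concatE:
  assumes "\<gamma> \<in> lang_concat X Y"
  obtains \<alpha> \<beta> where "\<gamma> = \<alpha> @ \<beta>" "\<alpha> \<in> X" "\<beta> \<in> Y"
  using assms by (auto simp: lang_concat_def)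

lemma lang_concat_mono: "\<lbrakk>X \<subseteq> X'; Y \<subseteq> Y'\<rbrakk> \<Longrightarrow> lang_concat X Y \<subseteq> lang_concat X' Y'"
  by (auto simp: lang_concat_def)

lemma lang_concat_assoc:
  "lang_concat (lang_concat X Y) Z = lang_concat X (lang_concat Y Z)"
  by (auto simp: lang_concat_def) (metis append.assoc)+

section \<open>Minimal word length\<close>

text \<open>The length function to be used in \<open>free_monoid_if_equidivisible\<close>. Its value
  on the empty language is unspecified.\<close>

definition min_length :: "'a list set \<Rightarrow> nat" where
  "min_length X = (LEAST n. n \<in> length ` X)"

lemma min_length_le: "\<alpha> \<in> X \<Longrightarrow> min_length X \<le> length \<alpha>"
  unfolding min_length_def by (auto intro: Least_le)

lemma min_length_witness:
  assumes "X \<noteq> {}"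
  obtains \<alpha> where "\<alpha> \<in> X" "length \<alpha> = min_length X"
proof -
  have "min_length X \<in> length ` X"
    unfolding min_length_def using assms by (auto intro: LeastI)
  then show ?thesis
    using that by auto
qed

lemma min_length_lang_concat:
  assumes "X \<noteq> {}" "Y \<noteq> {}"
  shows "min_length (lang_concat X Y) = min_length X + min_length Y"
proof (rule antisym)
  obtain \<alpha> \<beta> where "\<alpha> \<in> X" "length \<alpha> = min_length X" "\<beta> \<in> Y" "length \<beta> = min_length Y"
    using assms min_length_witness by metis
  then show "min_length (lang_concat X Y) \<le> min_length X + min_length Y"
    using min_length_le[OF lang_concatI, of \<alpha> X \<beta> Y] by simp
next
  have "lang_concat X Y \<noteq> {}"
    using assms by (auto simp: lang_concat_def)
  then obtain \<gamma> where "\<gamma> \<in> lang_concat X Y" "length \<gamma> = min_length (lang_concat X Y)"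
    using min_length_witness by blast
  then show "min_length X + min_length Y \<le> min_length (lang_concat X Y)"
    by (metis lang_concatE length_append add_mono min_length_le)
qed

lemma final_segmentsD:
  assumes "X \<in> final_segments A r"
  shows "X \<subseteq> lists A"
    and "\<lbrakk>\<alpha> \<in> X; \<beta> \<in> lists A; higman_le r \<alpha> \<beta>\<rbrakk> \<Longrightarrow> \<beta> \<in> X"
  using assms by (auto simp: final_segments_def)

section \<open>Closure properties of final segments\<close>

locale reflexive_alphabet =
  fixes A :: "'a set" and r :: "'a rel"
  assumes refl: "refl_on A r"
begin

text \<open>By reflexivity \<open>\<alpha>\<close> embeds into itself, and the empty word embeds
  into \<open>\<delta>\<close>. This absorption of prefixes and the dual absorption of suffixes
  drive all cutting arguments below.\<close>

lemma final_segment_appendL: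
  assumes "X \<in> final_segments A r" "\<alpha> \<in> X" "\<delta> \<in> lists A"
  shows "\<delta> @ \<alpha> \<in> X"
proof (rule final_segmentsD(2)[OF assms(1,2)])
  have \<alpha>: "\<alpha> \<in> lists A"
    using assms final_segmentsD(1) by blast
  then show "\<delta> @ \<alpha> \<in> lists A"
    using assms by simp
  show "higman_le r \<alpha> (\<delta> @ \<alpha>)"
    using higman_le_append_mono[OF higman_le_Nil higman_le_refl[OF refl \<alpha>]] by simp
qed

lemma final_segment_appendR:
  assumes "X \<in> final_segments A r" "\<alpha> \<in> X" "\<delta> \<in> lists A"
  shows "\<alpha> @ \<delta> \<in> X"
proof (rule final_segmentsD(2)[OF assms(1,2)])
  have \<alpha>: "\<alpha> \<in> lists A"
    using assms final_segmentsD(1) by blast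
  then show "\<alpha> @ \<delta> \<in> lists A"
    using assms by simp
  show "higman_le r \<alpha> (\<alpha> @ \<delta>)"
    using higman_le_append_mono[OF higman_le_refl[OF refl \<alpha>] higman_le_Nil] by simp
qed

text \<open>A word above \<open>\<alpha> @ \<beta>\<close> splits into a word above
  \<open>\<alpha>\<close> and a word above \<open>\<beta>\<close>, by
  \<open>higman_le_append_split\<close>.\<close>

lemma final_segment_lang_concat:
  assumes X: "X \<in> final_segments A r" and Y: "Y \<in> final_segments A r"
  shows "lang_concat X Y \<in> final_segments A r"
  unfolding final_segments_def
proof (intro CollectI conjI ballI impI subsetI)
  fix \<gamma> assume "\<gamma> \<in> lang_concat X Y"
  then show "\<gamma> \<in> lists A"
    using final_segmentsD(1)[OF X] final_segmentsD(1)[OF Y] by (fastforce elim!: lang_concatE)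
next
  fix \<gamma> \<delta> assume "\<gamma> \<in> lang_concat X Y" and \<delta>: "\<delta> \<in> lists A" "higman_le r \<gamma> \<delta>"
  then obtain \<alpha> \<beta> where "\<gamma> = \<alpha> @ \<beta>" and \<alpha>\<beta>: "\<alpha> \<in> X" "\<beta> \<in> Y"
    by (auto elim: lang_concatE)
  then obtain \<delta>1 \<delta>2 where "\<delta> = \<delta>1 @ \<delta>2" "higman_le r \<alpha> \<delta>1" "higman_le r \<beta> \<delta>2"
    using higman_le_append_split \<delta>(2) by metis
  then show "\<delta> \<in> lang_concat X Y"
    using \<delta>(1) \<alpha>\<beta> final_segmentsD(2)[OF X] final_segmentsD(2)[OF Y]
    by (auto intro!: lang_concatI)
qed

lemma lang_concat_lists_left:
  assumes "X \<in> final_segments A r"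
  shows "lang_concat (lists A) X = X"
proof
  show "lang_concat (lists A) X \<subseteq> X"
    using final_segment_appendL[OF assms] by (auto elim!: lang_concatE)
  show "X \<subseteq> lang_concat (lists A) X"
    using lang_concatI[of "[]" "lists A" _ X] by auto
qed

lemma lang_concat_lists_right:
  assumes "X \<in> final_segments A r"
  shows "lang_concat X (lists A) = X"
proof
  show "lang_concat X (lists A) \<subseteq> X"
    using final_segment_appendR[OF assms] by (auto elim!: lang_concatE)
  show "X \<subseteq> lang_concat X (lists A)"
    using lang_concatI[of _ X "[]" "lists A"] by auto
qed

section \<open>Cancellation and comparability of left factors\<close>

text \<open>No prefix of \<open>x\<close> lies in \<open>X\<close>, since otherwise absorption of
  suffixes would put \<open>x\<close> in \<open>X\<close>. Hence the cut of \<open>x @ y\<close>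
  falls strictly inside or at the end of \<open>y\<close>, and \<open>y'\<close> is strictly shorter
  than \<open>y\<close>; this descent contradicts minimality in later lemmas.\<close>

lemma right_factor_suffix:
  assumes X: "X \<in> final_segments A r" and "x @ y \<in> lang_concat X Y"
    and "x \<in> lists A" "x \<notin> X"
  obtains w y' where "y = w @ y'" "w \<noteq> []" "y' \<in> Y" "x @ w \<in> X"
proof -
  obtain x' y' where *: "x @ y = x' @ y'" "x' \<in> X" "y' \<in> Y"
    using assms(2) by (auto elim: lang_concatE)
  from *(1) obtain w where "(x = x' @ w \<and> w @ y = y') \<or> (x @ w = x' \<and> y = w @ y')"
    by (auto simp: append_eq_append_conv2)
  then show ?thesis
  proof
    assume w: "x = x' @ w \<and> w @ y = y'"
    then have "w \<in> lists A"
      using assms(3) by simp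
    then have "x \<in> X"
      using w *(2) final_segment_appendR[OF X] by simp
    then show ?thesis
      using assms(4) by contradiction
  next
    assume w: "x @ w = x' \<and> y = w @ y'"
    moreover have "w \<noteq> []"
      using w *(2) assms(4) by auto
    ultimately show ?thesis
      using that * by blast
  qed
qed

text \<open>Right cancellation, in a form for inclusions: a word of \<open>V\<close> outside
  \<open>X\<close>, followed by a shortest word of \<open>Y\<close>, would produce a still shorter
  word of \<open>Y\<close>.\<close>

lemma left_factor_subset:
  assumes X: "X \<in> final_segments A r" and V: "V \<in> final_segments A r"
    and "Y \<noteq> {}" and sub: "lang_concat V Y \<subseteq> lang_concat X Y"
  shows "V \<subseteq> X"
proof (rule ccontr)
  assume "\<not> V \<subseteq> X"
  then obtain v where v: "v \<in> V" "v \<notin> X" by blast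
  obtain y where y: "y \<in> Y" "length y = min_length Y"
    using min_length_witness[OF \<open>Y \<noteq> {}\<close>] .
  have "v @ y \<in> lang_concat X Y" "v \<in> lists A"
    using v(1) y(1) sub lang_concatI final_segmentsD(1)[OF V] by blast+
  then obtain w y' where "y = w @ y'" "w \<noteq> []" "y' \<in> Y"
    using right_factor_suffix[OF X] v(2) by metis
  then show False
    using y(2) min_length_le[of y' Y] by (simp flip: length_greater_0_conv)
qed

text \<open>Left cancellation: when \<open>z\<close> is a shortest word of \<open>Z\<close>, the cut
  of \<open>z @ p\<close> in \<open>lang_concat Z Q\<close> cannot come before the end of
  \<open>z\<close>. So \<open>p\<close> has a suffix in \<open>Q\<close>, and \<open>Q\<close>
  absorbs prefixes.\<close>

lemma right_factor_subset:
  assumes "Z \<noteq> {}" and P: "P \<in> final_segments A r" and Q: "Q \<in> final_segments A r"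
    and sub: "lang_concat Z P \<subseteq> lang_concat Z Q"
  shows "P \<subseteq> Q"
proof
  fix p assume p: "p \<in> P"
  obtain z where z: "z \<in> Z" "length z = min_length Z"
    using min_length_witness[OF \<open>Z \<noteq> {}\<close>] .
  have "z @ p \<in> lang_concat Z Q"
    using p z(1) sub lang_concatI by blast
  then obtain z' q where *: "z @ p = z' @ q" "z' \<in> Z" "q \<in> Q"
    by (auto elim: lang_concatE)
  moreover have "length z \<le> length z'"
    using z(2) min_length_le *(2) by metis
  ultimately obtain w where w: "p = w @ q"
    using append_eq_append_suffix by blast
  then have "w \<in> lists A"
    using p final_segmentsD(1)[OF P] by auto
  then show "p \<in> Q"
    using w *(3) final_segment_appendL[OF Q] by simp
qed

text \<open>Witnesses against both inclusions allow two descents, from a shortest \<open>y\<close>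
  in \<open>Y\<close> to a shorter \<open>t\<close> in \<open>T\<close> and from there to a still
  shorter \<open>y'\<close> in \<open>Y\<close>.\<close>

lemma left_factors_comparable:
  assumes X: "X \<in> final_segments A r" and Z: "Z \<in> final_segments A r"
    and "Y \<noteq> {}" and eq: "lang_concat X Y = lang_concat Z T"
  shows "X \<subseteq> Z \<or> Z \<subseteq> X"
proof (rule ccontr)
  assume "\<not> (X \<subseteq> Z \<or> Z \<subseteq> X)"
  then obtain x z where x: "x \<in> X" "x \<notin> Z" and z: "z \<in> Z" "z \<notin> X" by blast
  have xz: "x \<in> lists A" "z \<in> lists A"
    using x z final_segmentsD(1)[OF X] final_segmentsD(1)[OF Z] by auto
  obtain y where y: "y \<in> Y" "length y = min_length Y"
    using min_length_witness[OF \<open>Y \<noteq> {}\<close>] .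
  have "x @ y \<in> lang_concat Z T"
    using x y eq lang_concatI by blast
  then obtain w t where t: "y = w @ t" "w \<noteq> []" "t \<in> T"
    using right_factor_suffix[OF Z] x(2) xz by metis
  have "z @ t \<in> lang_concat X Y"
    using z t eq lang_concatI by blast
  then obtain w' y' where "t = w' @ y'" "w' \<noteq> []" "y' \<in> Y"
    using right_factor_suffix[OF X] z(2) xz by metis
  then show False
    using t y min_length_le[of y' Y] by (simp flip: length_greater_0_conv)
qed

section \<open>Residuals and equidivisibility\<close>

text \<open>This is the largest language \<open>U\<close> over \<open>A\<close> with
  \<open>lang_concat U Y \<subseteq> T\<close>. Appending a fixed \<open>y\<close> preserves the
  ordering, so upward closure is inherited from \<open>T\<close>.\<close>

lemma final_segment_residual:
  assumes Y: "Y \<in> final_segments A r" and T: "T \<in> final_segments A r"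
  shows "{u \<in> lists A. \<forall>y\<in>Y. u @ y \<in> T} \<in> final_segments A r"
  unfolding final_segments_def
proof (intro CollectI conjI ballI impI subsetI)
  fix u v y
  assume u: "u \<in> {u \<in> lists A. \<forall>y\<in>Y. u @ y \<in> T}"
    and v: "v \<in> lists A" "higman_le r u v" and y: "y \<in> Y"
  have "y \<in> lists A"
    using y final_segmentsD(1)[OF Y] by blast
  then have "higman_le r (u @ y) (v @ y)" "v @ y \<in> lists A"
    using v by (auto intro: higman_le_append_mono higman_le_refl[OF refl])
  then show "v @ y \<in> T"
    using u y final_segmentsD(2)[OF T] by blast
qed auto

lemma equidivisible_if_subset:
  assumes X: "X \<in> final_segments A r" "X \<noteq> {}" and Y: "Y \<in> final_segments A r" "Y \<noteq> {}"
    and Z: "Z \<in> final_segments A r" and T: "T \<in> final_segments A r"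
    and eq: "lang_concat X Y = lang_concat Z T" and "X \<subseteq> Z"
  shows "\<exists>U\<in>final_segments A r - {{}}. X = lang_concat Z U \<and> T = lang_concat U Y"
proof -
  define U where "U = {u \<in> lists A. \<forall>y\<in>Y. u @ y \<in> T}"
  have U: "U \<in> final_segments A r"
    unfolding U_def using Y(1) T by (rule final_segment_residual)
  have UY: "lang_concat U Y \<subseteq> T"
    by (auto simp: U_def elim!: lang_concatE)
  have X_sub: "X \<subseteq> lang_concat Z U"
  proof
    fix x assume x: "x \<in> X"
    have x_lists: "x \<in> lists A"
      using x final_segmentsD(1)[OF X(1)] by blast
    \<comment> \<open>The word \<open>x\<close> is itself such a prefix, with \<open>u\<close>
      empty.\<close>
    have "{z \<in> Z. \<exists>u. x = z @ u} \<noteq> {}"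
      using x \<open>X \<subseteq> Z\<close> by auto
    \<comment> \<open>Cutting \<open>x\<close> after its shortest prefix in \<open>Z\<close> works for all \<open>y \<in> Y\<close> simultaneously.\<close>
    then obtain z u where z: "z \<in> Z" "x = z @ u"
      and min: "length z = min_length {z \<in> Z. \<exists>u. x = z @ u}"
      by (rule min_length_witness) blast
    have "u @ y \<in> T" if y: "y \<in> Y" for y
    proof -
      have y_lists: "y \<in> lists A"
        using y final_segmentsD(1)[OF Y(1)] by blast
      have "x @ y \<in> lang_concat Z T"
        using x y eq lang_concatI by blast
      then obtain z' t where zt: "x @ y = z' @ t" "z' \<in> Z" "t \<in> T"
        by (auto elim: lang_concatE)
      \<comment> \<open>Either \<open>z'\<close> is a prefix of \<open>x\<close>, and
        \<open>z\<close> is a shortest such prefix in \<open>Z\<close>, or \<open>z'\<close> is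
        longer than \<open>x\<close>. So \<open>t\<close> is a suffix of \<open>u @ y\<close>, and
        \<open>T\<close> absorbs the remaining prefix \<open>w\<close>.\<close>
      have "length z \<le> length z'"
      proof (cases "length z' \<le> length x")
        case True
        then have "\<exists>u. x = z' @ u"
          using zt(1) by (auto simp: append_eq_append_conv2)
        then show ?thesis
          using zt(2) min min_length_le[of z' "{z \<in> Z. \<exists>u. x = z @ u}"] by simp
      qed (use z(2) in simp)
      moreover have "z @ (u @ y) = z' @ t"
        using zt(1) z(2) by simp
      ultimately obtain w where w: "u @ y = w @ t"
        using append_eq_append_suffix by blast
      have "u @ y \<in> lists A"
        using x_lists y_lists z(2) by simp
      then have "w \<in> lists A"
        unfolding w by simp
      then show ?thesis
        unfolding w using zt(3) final_segment_appendL[OF T] by blast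
    qed
    then have "u \<in> U"
      using x_lists z(2) by (simp add: U_def)
    then show "x \<in> lang_concat Z U"
      using z lang_concatI by blast
  qed
  have ZU: "lang_concat Z U \<in> final_segments A r"
    using Z U by (rule final_segment_lang_concat)
  \<comment> \<open>Prepares the cancellation of \<open>Y\<close> on the right.\<close>
  have "lang_concat (lang_concat Z U) Y \<subseteq> lang_concat X Y"
    unfolding lang_concat_assoc eq using UY by (intro lang_concat_mono) auto
  then have "lang_concat Z U \<subseteq> X"
    using left_factor_subset[OF X(1) ZU Y(2)] by blast
  then have X_eq: "X = lang_concat Z U"
    using X_sub by blast
  \<comment> \<open>The first allows cancelling \<open>Z\<close> on the left; the second makes
    \<open>U\<close> an element of the monoid.\<close>
  have "Z \<noteq> {}" "U \<noteq> {}"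
    using X(2) X_eq by (auto simp: lang_concat_def)
  have "lang_concat Z T \<subseteq> lang_concat Z (lang_concat U Y)"
    using eq unfolding X_eq lang_concat_assoc by simp
  then have "T \<subseteq> lang_concat U Y"
    using right_factor_subset[OF \<open>Z \<noteq> {}\<close> T final_segment_lang_concat[OF U Y(1)]] by blast
  then show ?thesis
    using X_eq UY U \<open>U \<noteq> {}\<close> by blast
qed

section \<open>The monoid of non-empty final segments\<close>

lemma lists_final_segment: "lists A \<in> final_segments A r"
  by (auto simp: final_segments_def)

lemma monoid_nonempty_final_segments: "monoid (nonempty_final_segment_monoid A r)"
proof (rule monoidI)
  show "\<one>\<^bsub>nonempty_final_segment_monoid A r\<^esub> \<in> carrier (nonempty_final_segment_monoid A r)"
    using lists_final_segment by (auto simp: nonempty_final_segment_monoid_def)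
  show "x \<otimes>\<^bsub>nonempty_final_segment_monoid A r\<^esub> y \<in> carrier (nonempty_final_segment_monoid A r)"
    if "x \<in> carrier (nonempty_final_segment_monoid A r)"
      "y \<in> carrier (nonempty_final_segment_monoid A r)" for x y
    using that final_segment_lang_concat
    by (auto simp: nonempty_final_segment_monoid_def lang_concat_def)
qed (auto simp: nonempty_final_segment_monoid_def lang_concat_assoc
      lang_concat_lists_left lang_concat_lists_right)

text \<open>A word of length 0 is the empty word, and a final segment containing it absorbs every
  word as a suffix.\<close>

lemma final_segment_min_length_zero:
  assumes "X \<in> final_segments A r" "X \<noteq> {}" "min_length X = 0"
  shows "X = lists A"
proof -
  have "[] \<in> X"
    using min_length_witness[OF assms(2)] unfolding assms(3) by auto
  then show ?thesis
    using final_segment_appendR[OF assms(1), of "[]"] final_segmentsD(1)[OF assms(1)] by auto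
qed

lemma free_monoid_nonempty_final_segments:
  "free_monoid (nonempty_final_segment_monoid A r)"
proof (rule monoid.free_monoid_if_equidivisible[OF monoid_nonempty_final_segments,
      where len = min_length], goal_cases)
  case (1 X Y Z T)
  then have segs: "X \<in> final_segments A r" "X \<noteq> {}" "Y \<in> final_segments A r" "Y \<noteq> {}"
      "Z \<in> final_segments A r" "Z \<noteq> {}" "T \<in> final_segments A r" "T \<noteq> {}"
    and eq: "lang_concat X Y = lang_concat Z T"
    by (auto simp: nonempty_final_segment_monoid_def)
  have "X \<subseteq> Z \<or> Z \<subseteq> X"
    using left_factors_comparable segs eq by blast
  \<comment> \<open>The inclusion that holds selects the alternative of equidivisibility; the second
    one exchanges \<open>X\<close>, \<open>Y\<close> with \<open>Z\<close>,
    \<open>T\<close>.\<close>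
  then show ?case
    using equidivisible_if_subset[OF segs(1-5,7) eq]
      equidivisible_if_subset[OF segs(5-8,1,3) eq[symmetric]]
    unfolding nonempty_final_segment_monoid_def monoid.simps partial_object.simps by blast
next
  case (2 X Y)
  then show ?case
    by (simp add: nonempty_final_segment_monoid_def min_length_lang_concat)
next
  case (3 X)
  then show ?case
    using final_segment_min_length_zero by (simp add: nonempty_final_segment_monoid_def)
qed

end

theorem theorem1:
  fixes A :: "'a set" and r :: "'a rel"
  assumes "partial_order_on A r"
  shows "free_monoid (nonempty_final_segment_monoid A r)"
proof -
  interpret reflexive_alphabet A r
    using assms by unfold_locales (simp add: partial_order_on_def preorder_on_def)
  show ?thesis
    by (rule free_monoid_nonempty_final_segments)
qed

end
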